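(* Let $O(Z_d)=\{gz'\mid z'\in Z_d\text{ and }g\in G\}$ and let $\overline{O(Z_d)}$ be its closure. Then $\overline{O(Z_d)}$ is an intermediate variety, i.e., it is a closed $G$-stable variety with $\overline{O(z)}\subseteq\overline{O(Z_d)}\subseteq\overline{O(y)}$.
   Context: Let $X$ be a finite dimensional complex vector space and $G\subseteq GL(X)$ a reductive algebraic group over $\mathbb C$ containing the center $\{tI\mid t\in\mathbb C^*\}$ of $GL(X)$. Let $V$ be a finite dimensional rational $G$-module on which $tI$ acts as multiplication by $t^c$, for a fixed integer $c\neq0$. Let $\lambda:\mathbb C^*\to G$ be a one-parameter subgroup, giving the grading $V=\oplus_iV_i$ with $\lambda(t)v_i=t^iv_i$ for $v_i\in V_i$. For a nonzero $v=\sum_iv_i\in V$, the leading term $\hat v$ is the nonzero component of smallest degree. Let $y\in V$ with $\lambda(t)y=t^dz+t^ey_e+\cdots+t^Dy_D$, $d<e<\cdots<D$, $z,y_e\neq0$, so $z=\hat y$ has degree $d$. $O(v)$ denotes the $G$-orbit of $v$ and $\overline{O(v)}$ its closure. Let $\pi_d:V\to V_d$ be the projection onto the weight space, $Y_d=\{y'\in O(y)\mid\widehat{y'}\text{ is of degree }d\}$, and $Z_d=\pi_d(Y_d)$, the set of leading terms of elements of $Y_d$. *)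

theory Defs
  imports Complex_Main "HOL-Analysis.Abstract_Topology" "HOL-Algebra.Coset"
begin

section \<open>Regular functions and Zariski topologies\<close>

inductive_set algebra_gen :: "('a \<Rightarrow> complex) set \<Rightarrow> ('a \<Rightarrow> complex) set"
  for S :: "('a \<Rightarrow> complex) set" where
  gen: "f \<in> S \<Longrightarrow> f \<in> algebra_gen S"
| const: "(\<lambda>_. a) \<in> algebra_gen S"
| add: "f \<in> algebra_gen S \<Longrightarrow> g \<in> algebra_gen S \<Longrightarrow> (\<lambda>x. f x + g x) \<in> algebra_gen S"
| mult: "f \<in> algebra_gen S \<Longrightarrow> g \<in> algebra_gen S \<Longrightarrow> (\<lambda>x. f x * g x) \<in> algebra_gen S"

text \<open>The topology on \<open>D\<close> whose closed sets are the common zero loci in \<open>D\<close> of functions from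
  the algebra generated by \<open>S\<close>.\<close>

definition zariski :: "('a \<Rightarrow> complex) set \<Rightarrow> 'a set \<Rightarrow> 'a topology" where
  "zariski S D = topology (\<lambda>U. \<exists>P \<subseteq> algebra_gen S. U = {x \<in> D. \<exists>f\<in>P. f x \<noteq> 0})"

lemma istopology_zariski:
  "istopology (\<lambda>U. \<exists>P \<subseteq> algebra_gen S. U = {x \<in> D. \<exists>f\<in>P. f x \<noteq> 0})"
  (is "istopology ?O")
proof -
  have "?O (U \<inter> W)" if "?O U" "?O W" for U W
  proof -
    from that obtain P Q where P: "P \<subseteq> algebra_gen S" "U = {x \<in> D. \<exists>f\<in>P. f x \<noteq> 0}"
      and Q: "Q \<subseteq> algebra_gen S" "W = {x \<in> D. \<exists>f\<in>Q. f x \<noteq> 0}"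
      by (elim exE conjE)
    have "(\<lambda>(f, g) x. f x * g x) ` (P \<times> Q) \<subseteq> algebra_gen S"
      using P(1) Q(1) by (auto intro: algebra_gen.mult)
    moreover have "U \<inter> W = {x \<in> D. \<exists>h \<in> (\<lambda>(f, g) x. f x * g x) ` (P \<times> Q). h x \<noteq> 0}"
      unfolding P(2) Q(2) by fastforce
    ultimately show ?thesis by (intro exI conjI)
  qed
  moreover have "?O (\<Union>K)" if "\<forall>U\<in>K. ?O U" for K
  proof -
    from that have "\<forall>U\<in>K. \<exists>P. P \<subseteq> algebra_gen S \<and> U = {x \<in> D. \<exists>f\<in>P. f x \<noteq> 0}" .
    then obtain P where P: "\<forall>U\<in>K. P U \<subseteq> algebra_gen S \<and> U = {x \<in> D. \<exists>f\<in>P U. f x \<noteq> 0}"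
      by (rule bchoice[THEN exE])
    have "x \<in> \<Union>K \<longleftrightarrow> x \<in> D \<and> (\<exists>f \<in> \<Union>(P ` K). f x \<noteq> 0)" for x
    proof -
      have "x \<in> U \<longleftrightarrow> x \<in> D \<and> (\<exists>f \<in> P U. f x \<noteq> 0)" if "U \<in> K" for U
        using P[rule_format, OF that, THEN conjunct2] by (simp add: set_eq_iff)
      then show ?thesis by auto
    qed
    then have "\<Union>K = {x \<in> D. \<exists>f \<in> \<Union>(P ` K). f x \<noteq> 0}" by (simp only: set_eq_iff mem_Collect_eq simp_thms)
    moreover have "\<Union>(P ` K) \<subseteq> algebra_gen S" using P by blast
    ultimately show ?thesis by (intro exI conjI)
  qed
  ultimately show ?thesis unfolding istopology_def by (intro conjI allI impI)
qed

lemma openin_zariski: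
  "openin (zariski S D) U \<longleftrightarrow> (\<exists>P \<subseteq> algebra_gen S. U = {x \<in> D. \<exists>f\<in>P. f x \<noteq> 0})"
  unfolding zariski_def topology_inverse'[OF istopology_zariski] ..

lemma topspace_zariski: "topspace (zariski S D) = D"
proof
  show "topspace (zariski S D) \<subseteq> D" unfolding topspace_def openin_zariski by blast
  have "openin (zariski S D) D"
    unfolding openin_zariski by (rule exI[of _ "{\<lambda>_. 1}"]) (auto intro: algebra_gen.const)
  then show "D \<subseteq> topspace (zariski S D)" by (rule openin_subset)
qed

lemma closedin_zariski:
  "closedin (zariski S D) C \<longleftrightarrow> (\<exists>P \<subseteq> algebra_gen S. C = {x \<in> D. \<forall>f\<in>P. f x = 0})"
proof
  assume "closedin (zariski S D) C"
  then obtain P where P: "P \<subseteq> algebra_gen S" and C: "C \<subseteq> D" "D - C = {x \<in> D. \<exists>f\<in>P. f x \<noteq> 0}"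
    unfolding closedin_def topspace_zariski openin_zariski by (elim exE conjE)
  have "C = D - (D - C)" using C(1) by auto
  also have "\<dots> = {x \<in> D. \<forall>f\<in>P. f x = 0}" unfolding C(2) by auto
  finally show "\<exists>P \<subseteq> algebra_gen S. C = {x \<in> D. \<forall>f\<in>P. f x = 0}"
    using P by (intro exI conjI)
next
  assume "\<exists>P \<subseteq> algebra_gen S. C = {x \<in> D. \<forall>f\<in>P. f x = 0}"
  then obtain P where P: "P \<subseteq> algebra_gen S" and C: "C = {x \<in> D. \<forall>f\<in>P. f x = 0}"
    by (elim exE conjE)
  have "C \<subseteq> D" "D - C = {x \<in> D. \<exists>f\<in>P. f x \<noteq> 0}" unfolding C by auto
  then show "closedin (zariski S D) C"
    unfolding closedin_def topspace_zariski openin_zariski using P by (intro exI conjI)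
qed

text \<open>A complex vector space is given by its scalar multiplication \<open>s\<close> on an abelian group.\<close>

abbreviation dual :: "(complex \<Rightarrow> 'v::ab_group_add \<Rightarrow> 'v) \<Rightarrow> ('v \<Rightarrow> complex) set" where
  "dual s \<equiv> {\<phi>. Vector_Spaces.linear s (*) \<phi>}"

abbreviation zariski_space :: "(complex \<Rightarrow> 'v::ab_group_add \<Rightarrow> 'v) \<Rightarrow> 'v topology" where
  "zariski_space s \<equiv> zariski (dual s) UNIV"


section \<open>Linear algebraic groups and rational modules\<close>

definition GL :: "(complex \<Rightarrow> 'v::ab_group_add \<Rightarrow> 'v) \<Rightarrow> ('v \<Rightarrow> 'v) monoid" where
  "GL s = \<lparr>carrier = {g. Vector_Spaces.linear s s g \<and> bij g}, monoid.mult = (\<circ>), one = id\<rparr>"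

text \<open>The coordinate ring of \<open>GL(X)\<close> is generated by the matrix coefficients of \<open>g\<close> together
  with \<open>1/det g\<close>, equivalently by the matrix coefficients of \<open>g\<close> and of \<open>g\<^sup>-\<^sup>1\<close>.\<close>

definition GL_coeffs :: "(complex \<Rightarrow> 'v::ab_group_add \<Rightarrow> 'v) \<Rightarrow> (('v \<Rightarrow> 'v) \<Rightarrow> complex) set" where
  "GL_coeffs s = {\<lambda>g. \<phi> (g x) | \<phi> x. \<phi> \<in> dual s} \<union> {\<lambda>g. \<phi> (inv_into UNIV g x) | \<phi> x. \<phi> \<in> dual s}"

abbreviation zariski_GL :: "(complex \<Rightarrow> 'v::ab_group_add \<Rightarrow> 'v) \<Rightarrow> ('v \<Rightarrow> 'v) topology" where
  "zariski_GL s \<equiv> zariski (GL_coeffs s) (carrier (GL s))"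

abbreviation subgp :: "(complex \<Rightarrow> 'v::ab_group_add \<Rightarrow> 'v) \<Rightarrow> ('v \<Rightarrow> 'v) set \<Rightarrow> ('v \<Rightarrow> 'v) monoid" where
  "subgp s G \<equiv> (GL s)\<lparr>carrier := G\<rparr>"

definition linear_algebraic_group ::
    "(complex \<Rightarrow> 'v::ab_group_add \<Rightarrow> 'v) \<Rightarrow> ('v \<Rightarrow> 'v) set \<Rightarrow> bool" where
  "linear_algebraic_group s G \<longleftrightarrow> subgroup G (GL s) \<and> closedin (zariski_GL s) G"

definition unipotent :: "('v::ab_group_add \<Rightarrow> 'v) \<Rightarrow> bool" where
  "unipotent g \<longleftrightarrow> (\<exists>n. \<forall>x. ((\<lambda>u. g u - u) ^^ n) x = 0)"

text \<open>Reductivity is triviality of the unipotent radical, the largest closed connected normal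
  unipotent subgroup. The group \<open>G\<close> itself need not be connected.\<close>

definition reductive :: "(complex \<Rightarrow> 'v::ab_group_add \<Rightarrow> 'v) \<Rightarrow> ('v \<Rightarrow> 'v) set \<Rightarrow> bool" where
  "reductive s G \<longleftrightarrow> linear_algebraic_group s G \<and>
    (\<forall>N. N \<lhd> subgp s G \<and> closedin (zariski_GL s) N \<and> connectedin (zariski_GL s) N \<and>
         (\<forall>g\<in>N. unipotent g) \<longrightarrow> N = {id})"

definition rational_module ::
    "(complex \<Rightarrow> 'x::ab_group_add \<Rightarrow> 'x) \<Rightarrow> (complex \<Rightarrow> 'v::ab_group_add \<Rightarrow> 'v) \<Rightarrow>
     ('x \<Rightarrow> 'x) set \<Rightarrow> (('x \<Rightarrow> 'x) \<Rightarrow> ('v \<Rightarrow> 'v)) \<Rightarrow> bool" where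
  "rational_module sX sV G \<rho> \<longleftrightarrow> \<rho> \<in> hom (subgp sX G) (GL sV) \<and>
    (\<forall>\<psi> \<in> dual sV. \<forall>v. \<exists>f \<in> algebra_gen (GL_coeffs sX). \<forall>g\<in>G. \<psi> (\<rho> g v) = f g)"

definition Gm :: "complex monoid" where
  "Gm = \<lparr>carrier = - {0}, monoid.mult = (*), one = 1\<rparr>"

text \<open>The regular functions on \<open>Gm\<close> are the Laurent polynomials.\<close>

definition one_parameter_subgroup ::
    "(complex \<Rightarrow> 'x::ab_group_add \<Rightarrow> 'x) \<Rightarrow> ('x \<Rightarrow> 'x) set \<Rightarrow> (complex \<Rightarrow> ('x \<Rightarrow> 'x)) \<Rightarrow> bool" where
  "one_parameter_subgroup s G l \<longleftrightarrow> l \<in> hom Gm (subgp s G) \<and>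
    (\<forall>\<phi> \<in> dual s. \<forall>x. \<exists>f \<in> algebra_gen {\<lambda>t. t, \<lambda>t. inverse t}. \<forall>t\<in>carrier Gm. \<phi> (l t x) = f t)"


section \<open>Gradings and leading terms\<close>

text \<open>Here \<open>r t = \<rho> (\<lambda>(t))\<close> is the action of the one-parameter subgroup on the module.\<close>

definition weight_space ::
    "(complex \<Rightarrow> 'v::ab_group_add \<Rightarrow> 'v) \<Rightarrow> (complex \<Rightarrow> 'v \<Rightarrow> 'v) \<Rightarrow> int \<Rightarrow> 'v set" where
  "weight_space s r i = {v. \<forall>t. t \<noteq> 0 \<longrightarrow> r t v = s (t powi i) v}"

definition weight_decomposition ::
    "(complex \<Rightarrow> 'v::ab_group_add \<Rightarrow> 'v) \<Rightarrow> (complex \<Rightarrow> 'v \<Rightarrow> 'v) \<Rightarrow> 'v \<Rightarrow> (int \<Rightarrow> 'v) \<Rightarrow> bool" where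
  "weight_decomposition s r v f \<longleftrightarrow> finite {i. f i \<noteq> 0} \<and> (\<forall>i. f i \<in> weight_space s r i) \<and>
    v = (\<Sum>i | f i \<noteq> 0. f i)"

text \<open>The projection \<open>\<pi>\<^sub>i\<close> onto the weight space of degree \<open>i\<close>. For a rational module every vector
  has exactly one decomposition into weight vectors.\<close>

definition weight_proj ::
    "(complex \<Rightarrow> 'v::ab_group_add \<Rightarrow> 'v) \<Rightarrow> (complex \<Rightarrow> 'v \<Rightarrow> 'v) \<Rightarrow> int \<Rightarrow> 'v \<Rightarrow> 'v" where
  "weight_proj s r i v = (THE f. weight_decomposition s r v f) i"

text \<open>Meaningful for \<open>v \<noteq> 0\<close> only.\<close>

definition leading_degree ::
    "(complex \<Rightarrow> 'v::ab_group_add \<Rightarrow> 'v) \<Rightarrow> (complex \<Rightarrow> 'v \<Rightarrow> 'v) \<Rightarrow> 'v \<Rightarrow> int" where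
  "leading_degree s r v = Min {i. weight_proj s r i v \<noteq> 0}"

definition orbit_set :: "('x \<Rightarrow> 'x) set \<Rightarrow> (('x \<Rightarrow> 'x) \<Rightarrow> 'v \<Rightarrow> 'v) \<Rightarrow> 'v set \<Rightarrow> 'v set" where
  "orbit_set G \<rho> A = {\<rho> g a | g a. g \<in> G \<and> a \<in> A}"

definition Y_deg :: "(complex \<Rightarrow> 'v::ab_group_add \<Rightarrow> 'v) \<Rightarrow> ('x \<Rightarrow> 'x) set \<Rightarrow>
    (('x \<Rightarrow> 'x) \<Rightarrow> 'v \<Rightarrow> 'v) \<Rightarrow> (complex \<Rightarrow> 'x \<Rightarrow> 'x) \<Rightarrow> 'v \<Rightarrow> int \<Rightarrow> 'v set" where
  "Y_deg s G \<rho> l y d =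
    {y' \<in> orbit_set G \<rho> {y}. y' \<noteq> 0 \<and> leading_degree s (\<lambda>t. \<rho> (l t)) y' = d}"

definition Z_deg :: "(complex \<Rightarrow> 'v::ab_group_add \<Rightarrow> 'v) \<Rightarrow> ('x \<Rightarrow> 'x) set \<Rightarrow>
    (('x \<Rightarrow> 'x) \<Rightarrow> 'v \<Rightarrow> 'v) \<Rightarrow> (complex \<Rightarrow> 'x \<Rightarrow> 'x) \<Rightarrow> 'v \<Rightarrow> int \<Rightarrow> 'v set" where
  "Z_deg s G \<rho> l y d = weight_proj s (\<lambda>t. \<rho> (l t)) d ` Y_deg s G \<rho> l y d"

end

theory Submission
  imports Defs "HOL-Computational_Algebra.Polynomial"
begin

text \<open>Let \<open>W\<close> be the closure of \<open>G Z\<^sub>d\<close>. It is stable under \<open>G\<close> because \<open>G Z\<^sub>d\<close> is and each \<open>\<rho> g\<close>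
  acts on \<open>V\<close> by a linear map, hence Zariski-continuously (\<open>closure_of_invariant\<close>). It
  contains the closure of \<open>G z\<close> because \<open>y\<close> itself has leading term \<open>z\<close>, so that \<open>z \<in> Z\<^sub>d\<close>.

  The inclusion of \<open>W\<close> in the closure of \<open>G y\<close> is the geometric point. Let \<open>y'\<close> in \<open>G y\<close> have
  leading degree \<open>d\<close> and weight components \<open>y'\<^sub>i\<close>. The curve
  \<open>t \<mapsto> t\<^sup>-\<^sup>d \<lambda>(t) y' = \<Sum>\<^sub>i t\<^sup>i\<^sup>-\<^sup>d y'\<^sub>i\<close> involves only nonnegative powers of \<open>t\<close>, so it extends to
  \<open>t = 0\<close>, where its value is the leading term \<open>y'\<^sub>d\<close>. For \<open>t \<noteq> 0\<close> the curve lies in \<open>G y\<close>: as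
  \<open>c \<noteq> 0\<close> there is \<open>u\<close> with \<open>u\<^sup>c = t\<^sup>-\<^sup>d\<close>, and the scalar \<open>t\<^sup>-\<^sup>d\<close> is the action of the central
  element \<open>u I\<close> of \<open>G\<close>. A polynomial vanishing on \<open>G y\<close> therefore vanishes along the curve off
  \<open>0\<close>, hence by continuity at \<open>0\<close> (\<open>weight_proj_leading_in_closure\<close>). So \<open>Z\<^sub>d\<close> lies in the closure of
  \<open>G y\<close>, and by stability so does \<open>G Z\<^sub>d\<close>.

  This argument reads the leading term off the weight decomposition, so every vector must have exactly
  one. Uniqueness is the linear independence of the powers of \<open>t\<close>. For existence
  (\<open>weight_decomposition_exists\<close>), rationality makes \<open>t \<mapsto> \<lambda>(t) v\<close> a Laurent polynomial with
  coefficients in \<open>V\<close>, and these coefficients are the weight components of \<open>v\<close>.\<close>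


section \<open>Zariski closures\<close>

lemma in_closure_of_zariski:
  "x \<in> zariski S UNIV closure_of A \<longleftrightarrow> (\<forall>f\<in>algebra_gen S. (\<forall>a\<in>A. f a = 0) \<longrightarrow> f x = 0)"
proof
  assume x: "x \<in> zariski S UNIV closure_of A"
  show "\<forall>f\<in>algebra_gen S. (\<forall>a\<in>A. f a = 0) \<longrightarrow> f x = 0"
  proof (intro ballI impI)
    fix f assume f: "f \<in> algebra_gen S" "\<forall>a\<in>A. f a = 0"
    have "closedin (zariski S UNIV) {a. f a = 0}"
      unfolding closedin_zariski using f(1) by (intro exI[of _ "{f}"]) auto
    then have "zariski S UNIV closure_of A \<subseteq> {a. f a = 0}"
      using f(2) by (intro closure_of_minimal) auto
    then show "f x = 0" using x by blast
  qed
next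
  assume x: "\<forall>f\<in>algebra_gen S. (\<forall>a\<in>A. f a = 0) \<longrightarrow> f x = 0"
  have "closedin (zariski S UNIV) (zariski S UNIV closure_of A)" by simp
  then obtain P where P: "P \<subseteq> algebra_gen S"
      "zariski S UNIV closure_of A = {x \<in> UNIV. \<forall>f\<in>P. f x = 0}"
    unfolding closedin_zariski by (elim exE conjE)
  have "A \<subseteq> zariski S UNIV closure_of A"
    by (rule closure_of_subset) (simp add: topspace_zariski)
  with P x show "x \<in> zariski S UNIV closure_of A" by blast
qed

text \<open>Pullback along \<open>h\<close> sends regular functions to regular functions as soon as it does so for
  generators. The comparison is restricted to \<open>D\<close> since maps out of \<open>GL(X)\<close> or \<open>\<complex>\<^sup>*\<close> are
  constrained only on those sets.\<close>

lemma algebra_gen_comp: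
  assumes "f \<in> algebra_gen S"
    and "\<And>\<phi>. \<phi> \<in> S \<Longrightarrow> \<exists>g\<in>algebra_gen T. \<forall>x\<in>D. \<phi> (h x) = g x"
  shows "\<exists>g\<in>algebra_gen T. \<forall>x\<in>D. f (h x) = g x"
  using assms(1)
proof induction
  case (gen f)
  then show ?case by (rule assms(2))
next
  case (const a)
  show ?case by (rule bexI[OF _ algebra_gen.const[of a]]) simp
next
  case (add f g)
  from add.IH obtain f' g' where "f' \<in> algebra_gen T" "g' \<in> algebra_gen T"
      "\<forall>x\<in>D. f (h x) = f' x" "\<forall>x\<in>D. g (h x) = g' x" by blast
  then show ?case by (intro bexI[OF _ algebra_gen.add[of f' _ g']]) auto
next
  case (mult f g)
  from mult.IH obtain f' g' where "f' \<in> algebra_gen T" "g' \<in> algebra_gen T"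
      "\<forall>x\<in>D. f (h x) = f' x" "\<forall>x\<in>D. g (h x) = g' x" by blast
  then show ?case by (intro bexI[OF _ algebra_gen.mult[of f' _ g']]) auto
qed

lemma image_closure_of_zariski_subset:
  assumes "\<And>\<phi>. \<phi> \<in> S \<Longrightarrow> (\<lambda>x. \<phi> (h x)) \<in> S"
  shows "h ` (zariski S UNIV closure_of A) \<subseteq> zariski S UNIV closure_of (h ` A)"
proof
  fix y assume "y \<in> h ` (zariski S UNIV closure_of A)"
  then obtain x where x: "x \<in> zariski S UNIV closure_of A" "y = h x" by blast
  show "y \<in> zariski S UNIV closure_of (h ` A)"
    unfolding in_closure_of_zariski
  proof (intro ballI impI)
    fix f assume f: "f \<in> algebra_gen S" "\<forall>a\<in>h ` A. f a = 0"
    have "\<exists>g\<in>algebra_gen S. \<forall>x\<in>UNIV. f (h x) = g x"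
      using f(1) by (rule algebra_gen_comp) (use assms algebra_gen.gen in fastforce)
    then obtain g where g: "g \<in> algebra_gen S" "\<And>x. f (h x) = g x" by auto
    then have "\<forall>a\<in>A. g a = 0" using f(2) by (auto simp flip: g(2))
    then show "f y = 0" using x g unfolding in_closure_of_zariski by simp
  qed
qed

text \<open>A polynomial vanishing on \<open>A\<close> vanishes along the curve away from \<open>0\<close>, and at \<open>0\<close> by continuity
  for the usual topology of \<open>\<complex>\<close>.\<close>

lemma curve_limit_in_closure_of_zariski:
  fixes h :: "complex \<Rightarrow> 'a"
  assumes h: "\<And>\<phi>. \<phi> \<in> S \<Longrightarrow> continuous_on UNIV (\<lambda>t. \<phi> (h t))"
    and A: "\<And>t. t \<noteq> 0 \<Longrightarrow> h t \<in> A"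
  shows "h 0 \<in> zariski S UNIV closure_of A"
  unfolding in_closure_of_zariski
proof (intro ballI impI)
  fix f assume f: "f \<in> algebra_gen S" "\<forall>a\<in>A. f a = 0"
  have "continuous_on UNIV (\<lambda>t. f (h t))"
    using f(1) by induction (simp_all add: h continuous_on_add continuous_on_mult)
  then have "((\<lambda>t. f (h t)) \<longlongrightarrow> f (h 0)) (at 0)"
    by (auto simp: continuous_on_def)
  moreover have "((\<lambda>t. f (h t)) \<longlongrightarrow> 0) (at 0)"
    by (rule tendsto_eventually) (use f(2) A in \<open>auto simp: eventually_at_filter\<close>)
  ultimately show "f (h 0) = 0"
    by (rule LIM_unique)
qed


section \<open>Laurent polynomials\<close>

text \<open>Laurent polynomials are handled as ordinary polynomials divided by a power of \<open>t\<close>.\<close>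

lemma Laurent_numerator:
  assumes "f \<in> algebra_gen {\<lambda>t. t, \<lambda>t. inverse t}"
  obtains n p where "\<And>t. t \<noteq> 0 \<Longrightarrow> t ^ n * f t = poly p t"
proof -
  have "\<exists>n p. \<forall>t. t \<noteq> 0 \<longrightarrow> t ^ n * f t = poly p t"
    using assms
  proof induction
    case (gen f)
    then consider "f = (\<lambda>t. t)" | "f = (\<lambda>t. inverse t)" by blast
    then show ?case
    proof cases
      case 1
      then show ?thesis by (intro exI[of _ 0] exI[of _ "[:0, 1:]"]) simp
    next
      case 2
      then show ?thesis by (intro exI[of _ 1] exI[of _ 1]) simp
    qed
  next
    case (const a)
    show ?case by (intro exI[of _ 0] exI[of _ "[:a:]"]) simp
  next
    case (add f g)
    then obtain n p m q where "\<forall>t. t \<noteq> 0 \<longrightarrow> t ^ n * f t = poly p t"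
        "\<forall>t. t \<noteq> 0 \<longrightarrow> t ^ m * g t = poly q t" by blast
    then show ?case
      by (intro exI[of _ "n + m"] exI[of _ "monom 1 m * p + monom 1 n * q"])
        (auto simp: poly_monom power_add algebra_simps)
  next
    case (mult f g)
    then obtain n p m q where eqs: "\<And>t. t \<noteq> 0 \<Longrightarrow> t ^ n * f t = poly p t"
        "\<And>t. t \<noteq> 0 \<Longrightarrow> t ^ m * g t = poly q t" by blast
    have "t ^ (n + m) * (f t * g t) = poly (p * q) t" if "t \<noteq> 0" for t
      using that by (simp add: power_add flip: eqs)
    then show ?case by blast
  qed
  then show thesis using that by blast
qed

text \<open>Multiplication by a large power of \<open>t\<close> gives a polynomial with infinitely many zeros.\<close>

lemma Laurent_coeff_eq_0:
  fixes a :: "int \<Rightarrow> complex"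
  assumes I: "finite I" and zero: "\<And>t. t \<noteq> 0 \<Longrightarrow> (\<Sum>i\<in>I. t powi i * a i) = 0" and j: "j \<in> I"
  shows "a j = 0"
proof -
  \<comment> \<open>This exponent clears all negative powers.\<close>
  define N where "N = (\<Sum>i\<in>I. \<bar>i\<bar>)"
  have N: "0 \<le> i + N" if "i \<in> I" for i
    using member_le_sum[OF that _ I, of abs] by (simp add: N_def)
  define p where "p = (\<Sum>i\<in>I. monom (a i) (nat (i + N)))"
  have "poly p t = 0" if "t \<noteq> 0" for t
  proof -
    have "poly p t = (\<Sum>i\<in>I. t powi N * (t powi i * a i))"
      unfolding p_def poly_sum
    proof (rule sum.cong)
      fix i assume i: "i \<in> I"
      have "t ^ nat (i + N) = t powi (i + N)"
        using N[OF i] by (simp add: power_int_def)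
      then show "poly (monom (a i) (nat (i + N))) t = t powi N * (t powi i * a i)"
        using that by (simp add: poly_monom power_int_add)
    qed simp
    then show ?thesis using zero[OF that] by (simp flip: sum_distrib_left)
  qed
  then have "- {0} \<subseteq> {t. poly p t = 0}" by auto
  moreover have "infinite (- {0 :: complex})"
    by (simp add: infinite_UNIV_char_0 Compl_eq_Diff_UNIV)
  ultimately have "p = 0"
    using poly_roots_finite[of p] finite_subset by blast
  then have "0 = (\<Sum>i\<in>I. coeff (monom (a i) (nat (i + N))) (nat (j + N)))"
    by (simp add: p_def del: coeff_monom flip: coeff_sum)
  also have "\<dots> = (\<Sum>i\<in>I. if i = j then a i else 0)"
    using N N[OF j] by (intro sum.cong) (auto simp: eq_nat_nat_iff)
  finally show ?thesis using I j by simp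
qed


section \<open>Rational representations of the multiplicative group\<close>

locale Gm_module = finite_dimensional_vector_space scale Basis
  for scale :: "complex \<Rightarrow> 'v::ab_group_add \<Rightarrow> 'v" (infixr \<open>*s\<close> 75) and Basis +
  fixes r :: "complex \<Rightarrow> 'v \<Rightarrow> 'v"
  assumes linear_action: "t \<noteq> 0 \<Longrightarrow> Vector_Spaces.linear scale scale (r t)"
    and action_one: "r 1 v = v"
    and action_mult: "t \<noteq> 0 \<Longrightarrow> u \<noteq> 0 \<Longrightarrow> r (t * u) v = r t (r u v)"
    and regular_action: "\<phi> \<in> dual scale \<Longrightarrow>
      \<exists>f\<in>algebra_gen {\<lambda>t. t, \<lambda>t. inverse t}. \<forall>t\<in>-{0}. \<phi> (r t v) = f t"
begin

abbreviation coord :: "'v \<Rightarrow> 'v \<Rightarrow> complex" where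
  "coord b v \<equiv> representation Basis v b"

lemma coord_dual: "coord b \<in> dual scale"
  using linear_representation[OF independent_Basis span_Basis] by simp

lemma dual_sum: "\<phi> \<in> dual scale \<Longrightarrow> \<phi> (\<Sum>i\<in>I. a i *s w i) = (\<Sum>i\<in>I. a i * \<phi> (w i))"
  by (simp add: linear_iff_module_hom module_hom.sum module_hom.scale)

lemma sum_coord: "(\<Sum>b\<in>Basis. coord b v *s b) = v"
  by (rule sum_representation_eq) (simp_all add: independent_Basis span_Basis finite_Basis)

lemma action_sum: "t \<noteq> 0 \<Longrightarrow> r t (\<Sum>i\<in>I. a i *s w i) = (\<Sum>i\<in>I. a i *s r t (w i))"
  using linear_action[of t] by (simp add: linear_iff_module_hom module_hom.sum module_hom.scale)

lemma zero_in_weight_space: "0 \<in> weight_space scale r i"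
proof -
  have "r t 0 = 0" if "t \<noteq> 0" for t
    using linear_action[OF that] by (simp add: linear_iff_module_hom module_hom.zero)
  then show ?thesis by (simp add: weight_space_def)
qed

lemma vector_Laurent_coeff_eq_0:
  assumes I: "finite I" and zero: "\<And>t. t \<noteq> 0 \<Longrightarrow> (\<Sum>i\<in>I. t powi i *s w i) = 0" and j: "j \<in> I"
  shows "w j = 0"
proof -
  have "coord b (w j) = 0" for b
  proof (rule Laurent_coeff_eq_0[OF I _ j])
    fix t :: complex assume "t \<noteq> 0"
    then have "coord b (\<Sum>i\<in>I. t powi i *s w i) = 0"
      by (simp add: zero representation_zero)
    then show "(\<Sum>i\<in>I. t powi i * coord b (w i)) = 0"
      by (simp add: dual_sum[OF coord_dual])
  qed
  then show ?thesis using sum_coord[of "w j"] by simp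
qed

text \<open>Each coordinate of \<open>r t v\<close> is a Laurent polynomial in \<open>t\<close>. There are finitely many coordinates,
  so they have a common denominator \<open>t ^ N\<close> and a common bound \<open>M\<close> on the degrees of the numerators;
  collecting the coefficients of each power of \<open>t\<close> gives vectors.\<close>

lemma orbit_map_Laurent:
  obtains I w where "finite I" "\<And>t. t \<noteq> 0 \<Longrightarrow> r t v = (\<Sum>i\<in>I. t powi i *s w i)"
proof -
  have "\<exists>n p. \<forall>t. t \<noteq> 0 \<longrightarrow> t ^ n * coord b (r t v) = poly p t" for b
  proof -
    obtain f where f: "f \<in> algebra_gen {\<lambda>t. t, \<lambda>t. inverse t}" "\<forall>t\<in>-{0}. coord b (r t v) = f t"
      using regular_action[OF coord_dual] by blast
    from Laurent_numerator[OF f(1)] f(2) show ?thesis by (metis ComplI singletonD)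
  qed
  then obtain n p where np: "\<And>b t. t \<noteq> 0 \<Longrightarrow> t ^ n b * coord b (r t v) = poly (p b) t"
    by metis
  define N where "N = sum n Basis"
  define q where "q b = monom 1 (N - n b) * p b" for b
  define M where "M = (\<Sum>b\<in>Basis. degree (q b))"
  define w where "w i = (\<Sum>b\<in>Basis. coeff (q b) (nat (i + int N)) *s b)" for i
  define I where "I = {- int N..int M - int N}"
  have coord: "coord b (r t v) = (\<Sum>i\<in>I. t powi i * coeff (q b) (nat (i + int N)))"
    if b: "b \<in> Basis" and t: "t \<noteq> 0" for b t
  proof -
    have nN: "n b \<le> N" unfolding N_def using b finite_Basis by (intro member_le_sum) auto
    have dM: "degree (q b) \<le> M"
      unfolding M_def using member_le_sum[OF b _ finite_Basis, of "\<lambda>b. degree (q b)"] by simp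
    have "t ^ N * coord b (r t v) = t ^ (N - n b) * (t ^ n b * coord b (r t v))"
      using nN by (simp flip: power_add mult.assoc)
    also have "\<dots> = poly (q b) t" using np[OF t] by (simp add: q_def poly_monom)
    also have "\<dots> = (\<Sum>k\<le>M. coeff (q b) k * t ^ k)"
      unfolding poly_altdef using dM
      by (intro sum.mono_neutral_left) (auto simp: coeff_eq_0)
    also have "\<dots> = (\<Sum>i\<in>I. t ^ N * (t powi i * coeff (q b) (nat (i + int N))))"
    proof (rule sum.reindex_bij_witness[of _ "\<lambda>i. nat (i + int N)" "\<lambda>k. int k - int N"])
      fix k assume "k \<in> {..M}"
      show "t ^ N * (t powi (int k - int N) * coeff (q b) (nat (int k - int N + int N))) =
          coeff (q b) k * t ^ k"
        using t by (simp add: power_int_diff)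
    qed (auto simp: I_def)
    finally show ?thesis using t by (simp flip: sum_distrib_left)
  qed
  have "r t v = (\<Sum>i\<in>I. t powi i *s w i)" if t: "t \<noteq> 0" for t
  proof -
    have "r t v = (\<Sum>b\<in>Basis. coord b (r t v) *s b)" by (rule sum_coord[symmetric])
    also have "\<dots> = (\<Sum>b\<in>Basis. \<Sum>i\<in>I. (t powi i * coeff (q b) (nat (i + int N))) *s b)"
      using coord t by (intro sum.cong) (auto simp: scale_sum_left)
    also have "\<dots> = (\<Sum>i\<in>I. t powi i *s w i)"
      by (subst sum.swap) (simp add: w_def scale_sum_right)
    finally show ?thesis .
  qed
  then show thesis using that[of I w] by (simp add: I_def)
qed

lemma weight_decomposition_finite_sum:
  assumes I: "finite I" and w: "\<And>i. f i \<in> weight_space scale r i" "\<And>i. i \<notin> I \<Longrightarrow> f i = 0"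
    and v: "v = (\<Sum>i\<in>I. f i)"
  shows "weight_decomposition scale r v f"
proof -
  have *: "{i. f i \<noteq> 0} \<subseteq> I" using w(2) by auto
  then have "v = (\<Sum>i | f i \<noteq> 0. f i)"
    unfolding v using I by (intro sum.mono_neutral_right) auto
  then show ?thesis
    unfolding weight_decomposition_def using w(1) finite_subset[OF * I] by simp
qed

lemma weight_decomposition_sum:
  assumes f: "weight_decomposition scale r v f" and I: "finite I" "\<And>i. i \<notin> I \<Longrightarrow> f i = 0"
    and t: "t \<noteq> 0"
  shows "r t v = (\<Sum>i\<in>I. t powi i *s f i)"
proof -
  have "v = (\<Sum>i | f i \<noteq> 0. f i)" using f by (simp add: weight_decomposition_def)
  also have "\<dots> = (\<Sum>i\<in>I. 1 *s f i)"
    using I by (intro sum.mono_neutral_cong_left) auto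
  finally have "r t v = (\<Sum>i\<in>I. 1 *s r t (f i))" by (simp only: action_sum[OF t])
  also have "\<dots> = (\<Sum>i\<in>I. t powi i *s f i)"
    using f t by (intro sum.cong) (auto simp: weight_decomposition_def weight_space_def)
  finally show ?thesis .
qed

lemma weight_decomposition_unique:
  assumes f: "weight_decomposition scale r v f" and g: "weight_decomposition scale r v g"
  shows "f = g"
proof
  fix j
  define I where "I = insert j ({i. f i \<noteq> 0} \<union> {i. g i \<noteq> 0})"
  have I: "finite I" using f g by (simp add: I_def weight_decomposition_def)
  have "f j - g j = 0"
  proof (rule vector_Laurent_coeff_eq_0[OF I])
    fix t :: complex assume t: "t \<noteq> 0"
    have "(\<Sum>i\<in>I. t powi i *s f i) = (\<Sum>i\<in>I. t powi i *s g i)"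
      using weight_decomposition_sum[OF f I _ t] weight_decomposition_sum[OF g I _ t]
      by (simp add: I_def)
    then show "(\<Sum>i\<in>I. t powi i *s (f i - g i)) = 0"
      by (simp add: scale_right_diff_distrib sum_subtractf)
  qed (simp add: I_def)
  then show "f j = g j" by simp
qed

text \<open>Write \<open>r t v = \<Sum>\<^sub>i t\<^sup>i w\<^sub>i\<close>. Expanding \<open>r (u t) v = r u (r t v)\<close> in both ways and comparing the
  coefficients of \<open>t\<^sup>i\<close> gives \<open>r u w\<^sub>i = u\<^sup>i w\<^sub>i\<close>, and \<open>t = 1\<close> gives \<open>v = \<Sum>\<^sub>i w\<^sub>i\<close>.\<close>

lemma weight_decomposition_exists: "\<exists>f. weight_decomposition scale r v f"
proof -
  obtain I w where I: "finite I" and w: "\<And>t. t \<noteq> 0 \<Longrightarrow> r t v = (\<Sum>i\<in>I. t powi i *s w i)"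
    using orbit_map_Laurent[of v] by blast
  have weight: "w i \<in> weight_space scale r i" if i: "i \<in> I" for i
    unfolding weight_space_def
  proof (intro CollectI allI impI)
    fix u :: complex assume u: "u \<noteq> 0"
    have "r u (w i) - u powi i *s w i = 0"
    proof (rule vector_Laurent_coeff_eq_0[OF I _ i])
      fix t :: complex assume t: "t \<noteq> 0"
      have "(\<Sum>i\<in>I. t powi i *s r u (w i)) = r u (r t v)"
        by (simp only: w[OF t] action_sum[OF u])
      also have "\<dots> = r (u * t) v" using action_mult[OF u t] by simp
      also have "\<dots> = (\<Sum>i\<in>I. t powi i *s u powi i *s w i)"
        using u t w[of "u * t"] by (simp add: power_int_mult_distrib mult.commute)
      finally show "(\<Sum>i\<in>I. t powi i *s (r u (w i) - u powi i *s w i)) = 0"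
        by (simp only: scale_right_diff_distrib sum_subtractf diff_self)
    qed
    then show "r u (w i) = u powi i *s w i" by simp
  qed
  have "weight_decomposition scale r v (\<lambda>i. if i \<in> I then w i else 0)"
    by (rule weight_decomposition_finite_sum[OF I])
      (use weight zero_in_weight_space w[of 1] action_one in auto)
  then show ?thesis by blast
qed

lemma weight_proj_eq: "weight_decomposition scale r v f \<Longrightarrow> weight_proj scale r i v = f i"
  unfolding weight_proj_def
  using the_equality[of "weight_decomposition scale r v" f] weight_decomposition_unique by metis

lemma weight_decomposition_weight_proj:
  "weight_decomposition scale r v (\<lambda>i. weight_proj scale r i v)"
proof -
  obtain f where f: "weight_decomposition scale r v f" using weight_decomposition_exists by blast
  then have "(\<lambda>i. weight_proj scale r i v) = f" using weight_proj_eq by blast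
  with f show ?thesis by simp
qed

text \<open>The leading term of \<open>v\<close> is the limit of \<open>t\<^sup>-\<^sup>d r t v\<close> as \<open>t\<close> tends to \<open>0\<close>, for \<open>d\<close> the leading
  degree.\<close>

lemma weight_proj_leading_in_closure:
  "weight_proj scale r (leading_degree scale r v) v \<in>
    zariski_space scale closure_of {t powi (- leading_degree scale r v) *s r t v | t. t \<noteq> 0}"
proof -
  define f where "f i = weight_proj scale r i v" for i
  define d where "d = leading_degree scale r v"
  \<comment> \<open>For \<open>v = 0\<close> the support is empty, yet evaluating \<open>h\<close> at \<open>0\<close> should pick out index \<open>d\<close>.\<close>
  define I where "I = insert d {i. f i \<noteq> 0}"
  define h where "h t = (\<Sum>i\<in>I. t ^ nat (i - d) *s f i)" for t
  have f: "weight_decomposition scale r v f"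
    using weight_decomposition_weight_proj by (simp add: f_def[abs_def])
  then have fin: "finite {i. f i \<noteq> 0}" by (simp add: weight_decomposition_def)
  then have I: "finite I" by (simp add: I_def)
  have d_le: "d \<le> i" if "i \<in> I" for i
    using that fin by (auto simp: I_def d_def leading_degree_def f_def)
  have "h 0 \<in> zariski_space scale closure_of {t powi (- d) *s r t v | t. t \<noteq> 0}"
  proof (rule curve_limit_in_closure_of_zariski)
    fix \<phi> assume "\<phi> \<in> dual scale"
    then show "continuous_on UNIV (\<lambda>t. \<phi> (h t))"
      unfolding h_def by (subst dual_sum) (auto intro!: continuous_intros)
  next
    fix t :: complex assume t: "t \<noteq> 0"
    have rt: "r t v = (\<Sum>i\<in>I. t powi i *s f i)"
      by (rule weight_decomposition_sum[OF f I _ t]) (simp add: I_def)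
    have "h t = t powi (- d) *s r t v"
      unfolding h_def rt scale_sum_right
    proof (rule sum.cong)
      fix i assume "i \<in> I"
      then have "t ^ nat (i - d) = t powi (- d + i)"
        using d_le[of i] by (simp add: power_int_def)
      also have "\<dots> = t powi (- d) * t powi i" using t by (intro power_int_add) simp
      finally have "t ^ nat (i - d) = t powi (- d) * t powi i" .
      then show "t ^ nat (i - d) *s f i = t powi (- d) *s t powi i *s f i"
        by simp
    qed simp
    then show "h t \<in> {t powi (- d) *s r t v | t. t \<noteq> 0}" using t by blast
  qed
  moreover have "h 0 = (\<Sum>i\<in>I. if i = d then f i else 0)"
    unfolding h_def using d_le by (intro sum.cong) (force simp: power_0_left)+
  then have "h 0 = f d" using I by (simp add: I_def)
  ultimately show ?thesis by (simp add: f_def d_def)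
qed

end


section \<open>Group actions\<close>

lemma group_GL:
  assumes "vector_space s"
  shows "group (GL s)"
proof (rule groupI)
  interpret vector_space s by fact
  fix g assume g: "g \<in> carrier (GL s)"
  then have lin: "Vector_Spaces.linear s s g" and bij: "bij g" by (auto simp: GL_def)
  have "Vector_Spaces.linear s s (inv_into UNIV g)"
    unfolding linear_iff_module_hom module_hom_iff
  proof (intro conjI allI)
    note ginv = bij_is_inj[OF bij, THEN inv_f_f] bij_is_surj[OF bij, THEN surj_f_inv_f]
    note hom = lin[unfolded linear_iff_module_hom]
    show "inv_into UNIV g (x + y) = inv_into UNIV g x + inv_into UNIV g y" for x y
      using module_hom.add[OF hom, of "inv_into UNIV g x" "inv_into UNIV g y"] ginv by metis
    show "inv_into UNIV g (s a x) = s a (inv_into UNIV g x)" for a x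
      using module_hom.scale[OF hom, of a "inv_into UNIV g x"] ginv by metis
  qed (rule module_axioms)+
  then show "\<exists>h\<in>carrier (GL s). h \<otimes>\<^bsub>GL s\<^esub> g = \<one>\<^bsub>GL s\<^esub>"
    using bij by (intro bexI[of _ "inv_into UNIV g"]) (auto simp: GL_def bij_imp_bij_inv bij_is_inj)
next
  interpret vector_space s by fact
  show "\<one>\<^bsub>GL s\<^esub> \<in> carrier (GL s)" by (simp add: GL_def linear_id)
qed (auto simp: GL_def intro: bij_comp Vector_Spaces.linear_compose)

text \<open>Continuity of \<open>\<rho> g\<close> gives one inclusion, continuity of \<open>\<rho> (g\<^sup>-\<^sup>1)\<close> the other.\<close>

lemma closure_of_invariant:
  assumes s: "vector_space sX" and G: "subgroup G (GL sX)" and \<rho>: "\<rho> \<in> hom (subgp sX G) (GL sV)"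
    and one: "\<And>v. \<rho> id v = v" and g: "g \<in> G"
    and A: "\<And>g. g \<in> G \<Longrightarrow> \<rho> g ` A \<subseteq> A"
  shows "\<rho> g ` (zariski_space sV closure_of A) = zariski_space sV closure_of A"
proof -
  interpret GL: group "GL sX" using s by (rule group_GL)
  have sub: "\<rho> h ` (zariski_space sV closure_of A) \<subseteq> zariski_space sV closure_of A" if h: "h \<in> G" for h
  proof -
    have "Vector_Spaces.linear sV sV (\<rho> h)"
      using \<rho> h by (auto simp: hom_def GL_def)
    then have "\<rho> h ` (zariski_space sV closure_of A) \<subseteq> zariski_space sV closure_of (\<rho> h ` A)"
      by (intro image_closure_of_zariski_subset) (auto dest: Vector_Spaces.linear_compose[unfolded o_def])
    also have "\<dots> \<subseteq> zariski_space sV closure_of A"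
      by (rule closure_of_mono[OF A[OF h]])
    finally show ?thesis .
  qed
  define k where "k = inv\<^bsub>GL sX\<^esub> g"
  have k: "k \<in> G" using G g by (simp add: k_def subgroup.m_inv_closed)
  have "g \<circ> k = id"
    using GL.r_inv[of g] subgroup.mem_carrier[OF G g] by (simp add: k_def GL_def)
  then have "\<rho> g (\<rho> k v) = v" for v
    using fun_cong[OF hom_mult[OF \<rho>, of g k], of v] g k one by (simp add: GL_def)
  then have "zariski_space sV closure_of A \<subseteq> \<rho> g ` (zariski_space sV closure_of A)"
    using sub[OF k] by (metis image_subset_iff image_eqI subsetI)
  with sub[OF g] show ?thesis by blast
qed

lemma orbit_set_invariant:
  assumes G: "subgroup G (GL sX)" and \<rho>: "\<rho> \<in> hom (subgp sX G) (GL sV)" and g: "g \<in> G"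
  shows "\<rho> g ` orbit_set G \<rho> A \<subseteq> orbit_set G \<rho> A"
proof (clarsimp simp: orbit_set_def)
  fix h a assume h: "h \<in> G" "a \<in> A"
  have "\<rho> g (\<rho> h a) = \<rho> (g \<circ> h) a" using hom_mult[OF \<rho>, of g h] g h by (simp add: GL_def)
  moreover have "g \<circ> h \<in> G" using subgroup.m_closed[OF G g h(1)] by (simp add: GL_def)
  ultimately show "\<exists>k b. \<rho> g (\<rho> h a) = \<rho> k b \<and> k \<in> G \<and> b \<in> A" using h by blast
qed

lemma exists_powi_root:
  fixes t :: complex
  assumes t: "t \<noteq> 0" and c: "c \<noteq> 0"
  obtains u where "u \<noteq> 0" "u powi c = t"
proof -
  define w where "w = of_real (ln (cmod t)) + \<i> * of_real (Arg t)"
  have "exp w = t"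
    using t rcis_cmod_Arg[of t] by (simp add: w_def exp_add cis_conv_exp rcis_def exp_of_real)
  have "exp (w / of_int c) powi c = t" using c \<open>exp w = t\<close> by (simp add: exp_power_int)
  then show thesis using that[of "exp (w / of_int c)"] by simp
qed

text \<open>Matrix coefficients of \<open>\<rho>\<close> are regular in those of \<open>g\<close> and \<open>g\<^sup>-\<^sup>1\<close>; on \<open>g = l t\<close> both are Laurent
  polynomials in \<open>t\<close>, the latter because \<open>(l t)\<^sup>-\<^sup>1 = l (t\<^sup>-\<^sup>1)\<close>.\<close>

lemma Gm_module_one_parameter_subgroup:
  assumes X: "vector_space sX" and V: "finite_dimensional_vector_space sV BV"
    and G: "subgroup G (GL sX)" and module: "rational_module sX sV G \<rho>"
    and one: "\<And>v. \<rho> id v = v"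
    and l: "one_parameter_subgroup sX G l"
  shows "Gm_module sV BV (\<lambda>t. \<rho> (l t))"
proof -
  interpret V: finite_dimensional_vector_space sV BV by fact
  have \<rho>: "\<rho> \<in> hom (subgp sX G) (GL sV)" using module by (simp add: rational_module_def)
  have l_hom: "l \<in> hom Gm (subgp sX G)" using l by (simp add: one_parameter_subgroup_def)
  have lG: "l t \<in> G" if "t \<noteq> 0" for t using l_hom that by (auto simp: hom_def Gm_def)
  have l_regular: "\<exists>f\<in>algebra_gen {\<lambda>t. t, \<lambda>t. inverse t}. \<forall>t\<in>-{0}. \<phi> (l t x) = f t"
    if "\<phi> \<in> dual sX" for \<phi> x
    using l that unfolding one_parameter_subgroup_def Gm_def by simp
  have l_mult: "l (t * u) = l t \<circ> l u" if "t \<noteq> 0" "u \<noteq> 0" for t u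
    using hom_mult[OF l_hom, of t u] that by (simp add: Gm_def GL_def)
  have l_bij: "bij (l t)" if "t \<noteq> 0" for t
    using subgroup.mem_carrier[OF G lG[OF that]] by (simp add: GL_def)
  \<comment> \<open>The bijection \<open>l 1\<close> is idempotent.\<close>
  have l_one: "l 1 = id"
  proof
    fix x
    have "l 1 (l 1 x) = l 1 x" using l_mult[of 1 1] by (simp add: fun_eq_iff)
    then show "l 1 x = id x" using bij_is_inj[OF l_bij[of 1]] by (simp add: inj_eq)
  qed
  have l_inv: "inv_into UNIV (l t) = l (inverse t)" if t: "t \<noteq> 0" for t
    using l_mult[of t "inverse t"] l_mult[of "inverse t" t] t l_one
    by (intro inv_unique_comp) simp_all
  show ?thesis
  proof (intro Gm_module.intro Gm_module_axioms.intro V)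
    fix t :: complex assume "t \<noteq> 0"
    then show "Vector_Spaces.linear sV sV (\<rho> (l t))"
      using \<rho> lG by (auto simp: hom_def GL_def)
  next
    show "\<rho> (l 1) v = v" for v by (simp add: l_one one)
  next
    fix t u :: complex and v assume "t \<noteq> 0" "u \<noteq> 0"
    then show "\<rho> (l (t * u)) v = \<rho> (l t) (\<rho> (l u) v)"
      using hom_mult[OF \<rho>, of "l t" "l u"] lG l_mult by (simp add: GL_def)
  next
    fix \<phi> v assume "\<phi> \<in> dual sV"
    then obtain f where f: "f \<in> algebra_gen (GL_coeffs sX)" "\<forall>g\<in>G. \<phi> (\<rho> g v) = f g"
      using module unfolding rational_module_def by blast
    let ?L = "algebra_gen {\<lambda>t::complex. t, \<lambda>t. inverse t}"
    have "\<exists>g\<in>?L. \<forall>t\<in>-{0}. f (l t) = g t"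
      using f(1)
    proof (rule algebra_gen_comp)
      fix k assume "k \<in> GL_coeffs sX"
      then consider \<phi> x where "\<phi> \<in> dual sX" "k = (\<lambda>g. \<phi> (g x))"
        | \<phi> x where "\<phi> \<in> dual sX" "k = (\<lambda>g. \<phi> (inv_into UNIV g x))"
        unfolding GL_coeffs_def by blast
      then show "\<exists>g\<in>?L. \<forall>t\<in>-{0}. k (l t) = g t"
      proof cases
        case 1
        then show ?thesis using l_regular by blast
      next
        case 2
        then obtain f where f: "f \<in> ?L" "\<forall>t\<in>-{0}. \<phi> (l t x) = f t"
          using l_regular by blast
        have "\<exists>g\<in>?L. \<forall>t\<in>-{0}. f (inverse t) = g t"
          using f(1)
        proof (rule algebra_gen_comp)
          fix k assume "k \<in> {\<lambda>t::complex. t, \<lambda>t. inverse t}"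
          then have "(\<lambda>t. k (inverse t)) \<in> ?L" by (auto intro: algebra_gen.gen)
          then show "\<exists>g\<in>?L. \<forall>t\<in>-{0}. k (inverse t) = g t"
            by (rule bexI[rotated]) simp
        qed
        then show ?thesis using f(2) l_inv 2(2) by auto
      qed
    qed
    then show "\<exists>g\<in>?L. \<forall>t\<in>-{0}. \<phi> (\<rho> (l t) v) = g t"
      using f(2) lG by auto
  qed
qed


section \<open>The closure of the orbits of leading terms\<close>

theorem lemma1p8:
  fixes sX :: "complex \<Rightarrow> 'x::ab_group_add \<Rightarrow> 'x" and BX :: "'x set"
    and sV :: "complex \<Rightarrow> 'v::ab_group_add \<Rightarrow> 'v" and BV :: "'v set"
    and G :: "('x \<Rightarrow> 'x) set" and \<rho> :: "('x \<Rightarrow> 'x) \<Rightarrow> 'v \<Rightarrow> 'v"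
    and l :: "complex \<Rightarrow> 'x \<Rightarrow> 'x" and c d e D :: int
    and y z :: 'v and yc :: "int \<Rightarrow> 'v"
  assumes X: "finite_dimensional_vector_space sX BX"
    and V: "finite_dimensional_vector_space sV BV"
    and G: "reductive sX G"
    and center: "\<And>t. t \<noteq> 0 \<Longrightarrow> sX t \<in> G"
    and module: "rational_module sX sV G \<rho>"
    and c: "c \<noteq> 0" "\<And>t v. t \<noteq> 0 \<Longrightarrow> \<rho> (sX t) v = sV (t powi c) v"
    and l: "one_parameter_subgroup sX G l"
    and degs: "d < e" "e \<le> D"
    and z: "z \<noteq> 0" "z \<in> weight_space sV (\<lambda>t. \<rho> (l t)) d"
    and yc: "yc e \<noteq> 0" "\<And>i. e \<le> i \<Longrightarrow> i \<le> D \<Longrightarrow> yc i \<in> weight_space sV (\<lambda>t. \<rho> (l t)) i"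
    and y: "\<And>t. t \<noteq> 0 \<Longrightarrow>
      \<rho> (l t) y = sV (t powi d) z + (\<Sum>i=e..D. sV (t powi i) (yc i))"
  shows "let W = zariski_space sV closure_of orbit_set G \<rho> (Z_deg sV G \<rho> l y d) in
    closedin (zariski_space sV) W \<and>
    (\<forall>g\<in>G. \<rho> g ` W = W) \<and>
    zariski_space sV closure_of orbit_set G \<rho> {z} \<subseteq> W \<and>
    W \<subseteq> zariski_space sV closure_of orbit_set G \<rho> {y}"
proof -
  interpret X: finite_dimensional_vector_space sX BX by fact
  interpret V: finite_dimensional_vector_space sV BV by fact
  have vX: "vector_space sX" ..
  have Gsub: "subgroup G (GL sX)"
    using G by (simp add: reductive_def linear_algebraic_group_def)
  have \<rho>: "\<rho> \<in> hom (subgp sX G) (GL sV)" using module by (simp add: rational_module_def)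
  have "sX 1 = id" by auto
  then have one: "\<rho> id v = v" for v using c(2)[of 1 v] by simp
  have idG: "id \<in> G" using subgroup.one_closed[OF Gsub] by (simp add: GL_def)
  define r where "r t = \<rho> (l t)" for t
  have r_eq: "(\<lambda>t. \<rho> (l t)) = r" by (simp add: r_def fun_eq_iff)
  interpret Gm_module sV BV r
    using Gm_module_one_parameter_subgroup[OF vX V Gsub module one l] unfolding r_eq .
  have lG: "l t \<in> G" if "t \<noteq> 0" for t
    using l that by (auto simp: one_parameter_subgroup_def hom_def Gm_def)
  let ?cl = "\<lambda>A. zariski_space sV closure_of A"
  let ?Z = "Z_deg sV G \<rho> l y d"
  have invariant: "\<rho> g ` ?cl (orbit_set G \<rho> A) = ?cl (orbit_set G \<rho> A)" if "g \<in> G" for g A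
    using closure_of_invariant[OF vX Gsub \<rho> one that] orbit_set_invariant[OF Gsub \<rho>]
    by blast
  have "z \<in> ?Z"
  proof -
    \<comment> \<open>At \<open>t = 1\<close> the expansion of \<open>l t y\<close> is the weight decomposition of \<open>y\<close>.\<close>
    define f where "f i = (if i = d then z else if i \<in> {e..D} then yc i else 0)" for i
    have "y = z + (\<Sum>i=e..D. yc i)"
      using y[of 1] action_one[of y] by (simp add: r_def)
    also have "\<dots> = (\<Sum>i\<in>insert d {e..D}. f i)"
      using degs by (auto simp: f_def intro!: sum.cong)
    finally have f: "weight_decomposition sV r y f"
      using z(2) yc(2) zero_in_weight_space unfolding r_eq
      by (intro weight_decomposition_finite_sum[of "insert d {e..D}"]) (auto simp: f_def)
    note proj = weight_proj_eq[OF f]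
    have "leading_degree sV r y = d"
      unfolding leading_degree_def proj
    proof (rule Min_eqI)
      show "finite {i. f i \<noteq> 0}" using f by (simp add: weight_decomposition_def)
    qed (use degs z(1) in \<open>auto simp: f_def split: if_splits\<close>)
    moreover have "y \<noteq> 0"
    proof
      assume "y = 0"
      then have "weight_decomposition sV r y (\<lambda>_. 0)"
        using zero_in_weight_space by (intro weight_decomposition_finite_sum[of "{}"]) auto
      then have "f d = 0" using weight_decomposition_unique[OF f] by simp
      then show False using z(1) by (simp add: f_def)
    qed
    moreover have "y \<in> orbit_set G \<rho> {y}"
      unfolding orbit_set_def using idG one[of y, symmetric] by blast
    ultimately have "y \<in> Y_deg sV G \<rho> l y d" by (simp add: Y_deg_def r_eq)
    moreover have "weight_proj sV r d y = z" using proj[of d] by (simp add: f_def)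
    ultimately show ?thesis unfolding Z_deg_def r_eq by force
  qed
  then have "orbit_set G \<rho> {z} \<subseteq> orbit_set G \<rho> ?Z" by (auto simp: orbit_set_def)
  then have lower: "?cl (orbit_set G \<rho> {z}) \<subseteq> ?cl (orbit_set G \<rho> ?Z)" by (rule closure_of_mono)
  have Z_sub: "?Z \<subseteq> ?cl (orbit_set G \<rho> {y})"
  proof
    fix x assume "x \<in> ?Z"
    then obtain y' where y': "y' \<in> orbit_set G \<rho> {y}" "leading_degree sV r y' = d"
        "x = weight_proj sV r d y'"
      by (auto simp: Z_deg_def Y_deg_def r_eq)
    have "{sV (t powi (- d)) (r t y') | t. t \<noteq> 0} \<subseteq> orbit_set G \<rho> {y}"
    proof clarify
      fix t :: complex assume t: "t \<noteq> 0"
      \<comment> \<open>The scalar \<open>t powi (- d)\<close> is realised by the central element \<open>sX u\<close> of \<open>G\<close>.\<close>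
      obtain u where u: "u \<noteq> 0" "u powi c = t powi (- d)"
        using exists_powi_root[of "t powi (- d)" c] t c(1) by auto
      have "sV (t powi (- d)) (r t y') = \<rho> (sX u) (\<rho> (l t) y')"
        using c(2)[OF u(1)] u(2) by (simp add: r_def)
      then show "sV (t powi (- d)) (r t y') \<in> orbit_set G \<rho> {y}"
        using y'(1) orbit_set_invariant[OF Gsub \<rho> lG[OF t]]
          orbit_set_invariant[OF Gsub \<rho> center[OF u(1)]] by fastforce
    qed
    then show "x \<in> ?cl (orbit_set G \<rho> {y})"
      using weight_proj_leading_in_closure[of y'] y' closure_of_mono by blast
  qed
  have "orbit_set G \<rho> ?Z \<subseteq> ?cl (orbit_set G \<rho> {y})"
  proof
    fix x assume "x \<in> orbit_set G \<rho> ?Z"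
    then obtain g a where x: "x = \<rho> g a" and g: "g \<in> G" and a: "a \<in> ?Z"
      unfolding orbit_set_def by blast
    have "\<rho> g a \<in> \<rho> g ` ?cl (orbit_set G \<rho> {y})" using a Z_sub by blast
    then show "x \<in> ?cl (orbit_set G \<rho> {y})" by (simp only: x invariant[OF g])
  qed
  then have upper: "?cl (orbit_set G \<rho> ?Z) \<subseteq> ?cl (orbit_set G \<rho> {y})"
    by (intro closure_of_minimal) auto
  show ?thesis
    unfolding Let_def using invariant lower upper by simp
qed

end
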